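(* Let $X$ be a compact $2$-dimensional simplicial complex such that: (1) every edge lies in exactly two $2$-faces; (2) the $2$-faces can be oriented so that along any edge the two orientations of the adjacent faces cancel; (3) $X$ is path-connected (in particular every vertex lies in an edge). Define an equivalence relation on the $2$-faces of $X$ by declaring $\sigma_0$ and $\sigma_k$ equivalent if there is a sequence of $2$-faces $\sigma_1,\dots,\sigma_{k-1}$ such that $\sigma_i$ and $\sigma_{i+1}$ share a common edge for $0\le i\le k-1$. Then the union of the faces in an equivalence class is an oriented compact $2$-dimensional pseudomanifold. Furthermore, there are finitely many equivalence classes, so $X$ is a union of finitely many oriented compact pseudomanifolds, any two of which can meet only in a finite set of vertices.
   Context: An $n$-dimensional pseudomanifold is an $n$-dimensional simplicial complex $X$ such that: (1) $X$ is the union of its $n$-simplices; (2) every $(n-1)$-simplex lies in exactly two $n$-simplices; (3) for any two $n$-simplices $\sigma_0,\sigma_k$ there is a sequence of $n$-simplices $\sigma_1,\dots,\sigma_{k-1}$ such that $\sigma_i$ and $\sigma_{i+1}$ share a common $(n-1)$-face for $0\le i\le k-1$. It is orientable if its $n$-simplices can be oriented so that for every $(n-1)$-simplex $\tau$ the two orientations induced from the two adjacent $n$-simplices cancel along $\tau$; it is oriented if such orientations have been chosen. *)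

theory Defs
  imports "HOL-Analysis.Analysis" "HOL-Combinatorics.Permutations"
begin

section \<open>Simplicial complexes and their geometric realizations\<close>

text \<open>
  A simplicial complex is given by the vertex sets of its simplices and may be infinite
  (\<open>HOL-Analysis.Polytope.simplicial_complex\<close> is finite by definition, so that compactness
  could not be stated as a hypothesis about it). Topological notions refer to the geometric
  realization defined below.
\<close>

definition abstract_simplicial_complex :: "'a set set \<Rightarrow> bool" where
  "abstract_simplicial_complex K \<longleftrightarrow>
     (\<forall>\<sigma>\<in>K. finite \<sigma> \<and> \<sigma> \<noteq> {} \<and> (\<forall>\<tau>. \<tau> \<subseteq> \<sigma> \<and> \<tau> \<noteq> {} \<longrightarrow> \<tau> \<in> K))"

text \<open>Dimensions are integers, so that \<open>n - 1\<close> is never truncated.\<close>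

definition simplices :: "int \<Rightarrow> 'a set set \<Rightarrow> 'a set set" where
  "simplices n K = {\<sigma> \<in> K. int (card \<sigma>) = n + 1}"

definition n_dimensional :: "int \<Rightarrow> 'a set set \<Rightarrow> bool" where
  "n_dimensional n K \<longleftrightarrow> simplices n K \<noteq> {} \<and> (\<forall>\<sigma>\<in>K. int (card \<sigma>) \<le> n + 1)"

text \<open>The points of a closed simplex are given by their barycentric coordinates.\<close>

definition closed_simplex :: "'a set \<Rightarrow> ('a \<Rightarrow> real) set" where
  "closed_simplex \<sigma> = {x. (\<forall>v. 0 \<le> x v) \<and> (\<forall>v. v \<notin> \<sigma> \<longrightarrow> x v = 0) \<and> sum x \<sigma> = 1}"

definition vertex_point :: "'a \<Rightarrow> 'a \<Rightarrow> real" where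
  "vertex_point v = (\<lambda>u. if u = v then 1 else 0)"

text \<open>
  The weak topology: a set is open iff it meets each closed simplex in a relatively open set.
  A closed simplex carries the subspace topology from the product topology on
  \<open>'a \<Rightarrow> real\<close>; its vertex set being finite, this is the Euclidean topology.
\<close>

definition geometric_realization :: "'a set set \<Rightarrow> ('a \<Rightarrow> real) topology" where
  "geometric_realization K = topology (\<lambda>U. U \<subseteq> (\<Union>\<sigma>\<in>K. closed_simplex \<sigma>) \<and>
     (\<forall>\<sigma>\<in>K. openin (top_of_set (closed_simplex \<sigma>)) (U \<inter> closed_simplex \<sigma>)))"

lemma openin_geometric_realization:
  "openin (geometric_realization K) U \<longleftrightarrow> U \<subseteq> (\<Union>\<sigma>\<in>K. closed_simplex \<sigma>) \<and>
     (\<forall>\<sigma>\<in>K. openin (top_of_set (closed_simplex \<sigma>)) (U \<inter> closed_simplex \<sigma>))"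
proof -
  define P where "P = (\<lambda>U. U \<subseteq> (\<Union>\<sigma>\<in>K. closed_simplex \<sigma>) \<and>
     (\<forall>\<sigma>\<in>K. openin (top_of_set (closed_simplex \<sigma>)) (U \<inter> closed_simplex \<sigma>)))"
  have "P (S \<inter> T)" if S: "P S" and T: "P T" for S T
    unfolding P_def
  proof (intro conjI ballI)
    show "S \<inter> T \<subseteq> (\<Union>\<sigma>\<in>K. closed_simplex \<sigma>)"
      using S unfolding P_def by (meson le_infI1)
    fix \<sigma> assume "\<sigma> \<in> K"
    then have "openin (top_of_set (closed_simplex \<sigma>))
        ((S \<inter> closed_simplex \<sigma>) \<inter> (T \<inter> closed_simplex \<sigma>))"
      using S T unfolding P_def by 
      (intro openin_Int [of _ "S \<inter> closed_simplex \<sigma>" "T \<inter> closed_simplex \<sigma>"]) (simp_all only:)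
    moreover have "(S \<inter> closed_simplex \<sigma>) \<inter> (T \<inter> closed_simplex \<sigma>) = S \<inter> T \<inter> closed_simplex \<sigma>"
      by (simp add: Int_ac)
    ultimately show "openin (top_of_set (closed_simplex \<sigma>)) (S \<inter> T \<inter> closed_simplex \<sigma>)"
      by (simp only:)
  qed
  moreover have "P (\<Union>\<U>)" if \<U>: "\<forall>S\<in>\<U>. P S" for \<U>
    unfolding P_def
  proof (intro conjI ballI)
    show "\<Union>\<U> \<subseteq> (\<Union>\<sigma>\<in>K. closed_simplex \<sigma>)"
      using \<U> unfolding P_def by (intro Union_least) (simp only:)
    fix \<sigma> assume \<sigma>: "\<sigma> \<in> K"
    have "openin (top_of_set (closed_simplex \<sigma>)) (\<Union>S\<in>\<U>. S \<inter> closed_simplex \<sigma>)"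
    proof (rule openin_Union)
      fix V assume "V \<in> (\<lambda>S. S \<inter> closed_simplex \<sigma>) ` \<U>"
      then obtain S where "S \<in> \<U>" and V: "V = S \<inter> closed_simplex \<sigma>" by (rule imageE)
      then have "P S" using \<U> by (simp only:)
      then show "openin (top_of_set (closed_simplex \<sigma>)) V"
        using \<sigma> unfolding P_def V by (simp only:)
    qed
    then show "openin (top_of_set (closed_simplex \<sigma>)) (\<Union>\<U> \<inter> closed_simplex \<sigma>)"
      by (simp only: Int_Union2)
  qed
  ultimately have "istopology P"
    by (simp only: istopology_def) (intro conjI allI impI; assumption)
  then have "openin (topology P) = P"
    by (rule topology_inverse')
  moreover have "geometric_realization K = topology P"
    by (simp only: geometric_realization_def P_def)
  ultimately show ?thesis
    by (simp only: P_def)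
qed

lemma topspace_geometric_realization:
  "topspace (geometric_realization K) = (\<Union>\<sigma>\<in>K. closed_simplex \<sigma>)" (is "_ = ?S")
proof
  show "topspace (geometric_realization K) \<subseteq> ?S"
    unfolding topspace_def openin_geometric_realization by blast
  have "?S \<inter> closed_simplex \<sigma> = closed_simplex \<sigma>" if "\<sigma> \<in> K" for \<sigma>
    using that by blast
  then have "openin (geometric_realization K) ?S"
    by (simp add: openin_geometric_realization)
  then show "?S \<subseteq> topspace (geometric_realization K)"
    by (rule openin_subset)
qed

definition generated_subcomplex :: "'a set set \<Rightarrow> 'a set set" where
  "generated_subcomplex S = {\<tau>. \<tau> \<noteq> {} \<and> (\<exists>\<sigma>\<in>S. \<tau> \<subseteq> \<sigma>)}"

text \<open>So the space of the subcomplex generated by \<open>S\<close> is the union of the simplices in \<open>S\<close>.\<close>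

lemma topspace_generated_subcomplex:
  assumes "\<And>\<sigma>. \<sigma> \<in> S \<Longrightarrow> finite \<sigma> \<and> \<sigma> \<noteq> {}"
  shows "topspace (geometric_realization (generated_subcomplex S)) = (\<Union>\<sigma>\<in>S. closed_simplex \<sigma>)"
proof -
  have mono: "closed_simplex \<tau> \<subseteq> closed_simplex \<sigma>" if "\<sigma> \<in> S" "\<tau> \<subseteq> \<sigma>" for \<sigma> \<tau>
  proof
    fix x assume "x \<in> closed_simplex \<tau>"
    then have x: "\<forall>v. 0 \<le> x v" "\<forall>v. v \<notin> \<tau> \<longrightarrow> x v = 0" "sum x \<tau> = 1"
      by (auto simp: closed_simplex_def)
    have "sum x \<tau> = sum x \<sigma>"
      using that assms x(2) by (intro sum.mono_neutral_left) auto
    with x that show "x \<in> closed_simplex \<sigma>" by (auto simp: closed_simplex_def)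
  qed
  have "(\<Union>\<tau>\<in>generated_subcomplex S. closed_simplex \<tau>) \<subseteq> (\<Union>\<sigma>\<in>S. closed_simplex \<sigma>)"
  proof (rule UN_least)
    fix \<tau> assume "\<tau> \<in> generated_subcomplex S"
    then obtain \<sigma> where "\<sigma> \<in> S" "\<tau> \<subseteq> \<sigma>"
      by (auto simp: generated_subcomplex_def)
    then have "closed_simplex \<tau> \<subseteq> closed_simplex \<sigma>"
      by (rule mono)
    also have "\<dots> \<subseteq> (\<Union>\<sigma>\<in>S. closed_simplex \<sigma>)"
      using \<open>\<sigma> \<in> S\<close> by (rule UN_upper)
    finally show "closed_simplex \<tau> \<subseteq> (\<Union>\<sigma>\<in>S. closed_simplex \<sigma>)" .
  qed
  moreover have "S \<subseteq> generated_subcomplex S"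
  proof
    fix \<sigma> assume "\<sigma> \<in> S"
    with assms [OF this] show "\<sigma> \<in> generated_subcomplex S"
      by (auto simp: generated_subcomplex_def)
  qed
  then have "(\<Union>\<sigma>\<in>S. closed_simplex \<sigma>) \<subseteq> (\<Union>\<tau>\<in>generated_subcomplex S. closed_simplex \<tau>)"
    by (rule UN_mono) (rule order_refl)
  ultimately have "(\<Union>\<tau>\<in>generated_subcomplex S. closed_simplex \<tau>) = (\<Union>\<sigma>\<in>S. closed_simplex \<sigma>)"
    by (rule equalityI)
  then show ?thesis
    by (simp only: topspace_geometric_realization)
qed


section \<open>Orientations\<close>

definition orderings :: "'a set \<Rightarrow> 'a list set" where
  "orderings \<sigma> = {xs. distinct xs \<and> set xs = \<sigma>}"

text \<open>
  An orientation of a simplex is given by its set \<open>Os\<close> of positive orderings: even permutations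
  preserve and odd permutations reverse the sign of an ordering. For a simplex of positive
  dimension, \<open>Os\<close> is one of the two classes of orderings modulo even permutations; for a vertex
  \<open>v\<close>, it is \<open>{[v]}\<close> or \<open>{}\<close>, the signs \<open>+\<close> and \<open>-\<close>.
\<close>

definition is_orientation :: "'a set \<Rightarrow> 'a list set \<Rightarrow> bool" where
  "is_orientation \<sigma> Os \<longleftrightarrow> Os \<subseteq> orderings \<sigma> \<and>
     (\<forall>xs\<in>orderings \<sigma>. \<forall>p. p permutes {..<length xs} \<longrightarrow>
        (permute_list p xs \<in> Os \<longleftrightarrow> (xs \<in> Os \<longleftrightarrow> evenperm p)))"

text \<open>
  The usual convention: the facet of \<open>[v\<^sub>0, \<dots>, v\<^sub>n]\<close> that omits \<open>v\<^sub>i\<close> gets the sign \<open>(-1)^i\<close>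
  (move \<open>v\<^sub>i\<close> to the front, then drop it).
\<close>

definition induced_orientation :: "'a set \<Rightarrow> 'a list set \<Rightarrow> 'a set \<Rightarrow> 'a list set" where
  "induced_orientation \<sigma> Os \<tau> = {ys \<in> orderings \<tau>. \<exists>v\<in>\<sigma> - \<tau>. v # ys \<in> Os}"

definition opposite_orientation :: "'a set \<Rightarrow> 'a list set \<Rightarrow> 'a list set" where
  "opposite_orientation \<tau> Os = orderings \<tau> - Os"

definition coherently_oriented :: "int \<Rightarrow> 'a set set \<Rightarrow> ('a set \<Rightarrow> 'a list set) \<Rightarrow> bool" where
  "coherently_oriented n K \<omega> \<longleftrightarrow>
     (\<forall>\<sigma>\<in>simplices n K. is_orientation \<sigma> (\<omega> \<sigma>)) \<and>
     (\<forall>\<tau>\<in>simplices (n - 1) K. \<forall>\<sigma>\<in>simplices n K. \<forall>\<sigma>'\<in>simplices n K.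
        \<sigma> \<noteq> \<sigma>' \<and> \<tau> \<subseteq> \<sigma> \<and> \<tau> \<subseteq> \<sigma>' \<longrightarrow>
        induced_orientation \<sigma>' (\<omega> \<sigma>') \<tau> =
          opposite_orientation \<tau> (induced_orientation \<sigma> (\<omega> \<sigma>) \<tau>))"


section \<open>Pseudomanifolds\<close>

definition two_cofaces :: "int \<Rightarrow> 'a set set \<Rightarrow> bool" where
  "two_cofaces n K \<longleftrightarrow> (\<forall>\<tau>\<in>simplices (n - 1) K. card {\<sigma> \<in> simplices n K. \<tau> \<subseteq> \<sigma>} = 2)"

definition chain_rel :: "int \<Rightarrow> 'a set set \<Rightarrow> ('a set \<times> 'a set) set" where
  "chain_rel n K = {(\<sigma>, \<sigma>'). \<exists>(k::nat) s. s 0 = \<sigma> \<and> s k = \<sigma>' \<and>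
     (\<forall>i\<le>k. s i \<in> simplices n K) \<and>
     (\<forall>i<k. \<exists>\<tau>\<in>simplices (n - 1) K. \<tau> \<subseteq> s i \<and> \<tau> \<subseteq> s (Suc i))}"

definition pseudomanifold :: "int \<Rightarrow> 'a set set \<Rightarrow> bool" where
  "pseudomanifold n K \<longleftrightarrow>
     abstract_simplicial_complex K \<and> n_dimensional n K \<and>
     topspace (geometric_realization K) = (\<Union>\<sigma>\<in>simplices n K. closed_simplex \<sigma>) \<and>
     two_cofaces n K \<and>
     (\<forall>\<sigma>\<in>simplices n K. \<forall>\<sigma>'\<in>simplices n K. (\<sigma>, \<sigma>') \<in> chain_rel n K)"

definition oriented_pseudomanifold ::
    "int \<Rightarrow> 'a set set \<Rightarrow> ('a set \<Rightarrow> 'a list set) \<Rightarrow> bool" where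
  "oriented_pseudomanifold n K \<omega> \<longleftrightarrow> pseudomanifold n K \<and> coherently_oriented n K \<omega>"

definition chain_classes :: "int \<Rightarrow> 'a set set \<Rightarrow> 'a set set set" where
  "chain_classes n K = simplices n K // chain_rel n K"

abbreviation union_of_faces :: "'a set set \<Rightarrow> ('a \<Rightarrow> real) set" where
  "union_of_faces C \<equiv> topspace (geometric_realization (generated_subcomplex C))"

end

theory Submission
  imports Defs
begin

text \<open>
  The barycentres of the simplices form a closed discrete subset of the realization, so a compact
  complex is finite. A vertex in no edge would be a clopen point, which connectedness excludes;
  hence every simplex lies in a 2-face. All faces around an edge are equivalent, so a class
  \<open>C\<close> contains both cofaces of each of its edges, and faces from different classes share no
  edge, hence at most one vertex.
\<close>

section \<open>Closed simplices\<close>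

lemma face_in_complex:
  assumes "abstract_simplicial_complex K" "\<sigma> \<in> K" "\<tau> \<subseteq> \<sigma>" "\<tau> \<noteq> {}"
  shows "\<tau> \<in> K"
  using assms unfolding abstract_simplicial_complex_def by blast

lemma closed_simplex_support_subset:
  assumes "x \<in> closed_simplex \<sigma>"
  shows "{v. x v \<noteq> 0} \<subseteq> \<sigma>"
  using assms by (auto simp: closed_simplex_def)

lemma closed_simplex_support_nonempty:
  assumes "x \<in> closed_simplex \<sigma>"
  shows "{v. x v \<noteq> 0} \<noteq> {}"
proof
  assume "{v. x v \<noteq> 0} = {}"
  then have "sum x \<sigma> = 0" by (intro sum.neutral) auto
  with assms show False by (simp add: closed_simplex_def)
qed

text \<open>The single nonzero coordinate carries the whole sum 1. This identifies the points shared
  by two classes once their support is known to be one vertex.\<close>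

lemma closed_simplex_support_singleton:
  assumes "x \<in> closed_simplex \<sigma>" "finite \<sigma>" "{u. x u \<noteq> 0} = {v}"
  shows "x = vertex_point v"
proof -
  have v: "v \<in> \<sigma>" using closed_simplex_support_subset[OF assms(1)] assms(3) by auto
  have "sum x \<sigma> = sum x {v}"
    using assms(2,3) v by (intro sum.mono_neutral_right) auto
  then have "x v = 1" using assms(1) by (simp add: closed_simplex_def)
  then show ?thesis using assms(3) by (auto simp: vertex_point_def fun_eq_iff)
qed

lemma closed_simplex_singleton: "closed_simplex {v} = {vertex_point v}"
proof -
  have "vertex_point v \<in> closed_simplex {v}"
    by (simp add: closed_simplex_def vertex_point_def)
  moreover have "x = vertex_point v" if "x \<in> closed_simplex {v}" for x
    using closed_simplex_support_singleton[OF that] closed_simplex_support_subset[OF that]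
      closed_simplex_support_nonempty[OF that] by blast
  ultimately show ?thesis by blast
qed

lemma vertex_point_in_closed_simplex_iff:
  assumes "finite \<sigma>"
  shows "vertex_point v \<in> closed_simplex \<sigma> \<longleftrightarrow> v \<in> \<sigma>"
  using assms by (auto simp: closed_simplex_def vertex_point_def)

text \<open>The simplex is a closed subset of a cube in the product space, which is compact even
  when the vertex type is infinite. Each remaining condition involves only finitely many
  coordinates, hence is closed.\<close>

lemma compact_closed_simplex:
  assumes "finite \<sigma>"
  shows "compact (closed_simplex \<sigma>)"
proof -
  have cont: "continuous_on UNIV (\<lambda>x::'a \<Rightarrow> real. x v)" for v
    by (rule continuous_on_product_coordinates)
  \<comment> \<open>Tychonoff's theorem, transferred to the function type through its product
    topology.\<close>
  have cube: "compact (PiE UNIV (\<lambda>_::'a. {0..1::real}))"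
    unfolding compactin_euclidean_iff[symmetric] euclidean_product_topology[symmetric] compactin_PiE
    by (simp add: compactin_euclidean_iff)
  have "closed_simplex \<sigma> =
      PiE UNIV (\<lambda>_. {0..1}) \<inter> ((\<Inter>v\<in>-\<sigma>. {x. x v = 0}) \<inter> {x. sum x \<sigma> = 1})" (is "_ = ?R")
  proof
    show "closed_simplex \<sigma> \<subseteq> ?R"
    proof
      fix x assume x: "x \<in> closed_simplex \<sigma>"
      \<comment> \<open>The upper bound is implicit in the definition: nonnegative coordinates with
        sum 1 are each at most 1.\<close>
      have "x v \<le> 1" for v
      proof (cases "v \<in> \<sigma>")
        case True
        then have "x v \<le> sum x \<sigma>"
          using x assms by (intro member_le_sum) (auto simp: closed_simplex_def)
        then show ?thesis using x by (simp add: closed_simplex_def)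
      qed (use x in \<open>simp add: closed_simplex_def\<close>)
      then show "x \<in> ?R" using x by (auto simp: closed_simplex_def)
    qed
    show "?R \<subseteq> closed_simplex \<sigma>"
      by (auto simp: closed_simplex_def PiE_iff)
  qed
  moreover have "closed {x::'a \<Rightarrow> real. x v = 0}" for v
    by (intro closed_Collect_eq cont continuous_on_const)
  moreover have "closed {x::'a \<Rightarrow> real. sum x \<sigma> = 1}"
    by (intro closed_Collect_eq continuous_on_sum cont continuous_on_const)
  ultimately show ?thesis
    by (metis (no_types, lifting) cube closed_INT closed_Int compact_Int_closed)
qed

section \<open>Compactness and finiteness\<close>

lemma openin_geometric_realization_Int:
  assumes "openin (geometric_realization K) U" "\<sigma> \<in> K"
  shows "\<exists>T. open T \<and> U \<inter> closed_simplex \<sigma> = closed_simplex \<sigma> \<inter> T"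
  using assms by (auto simp: openin_geometric_realization openin_open)

text \<open>The realization is a finite union of closed simplices, so it suffices that each is
  compact in the weak topology. Weakly open sets have relatively open traces on a simplex, so
  compactness in the product topology carries over.\<close>

lemma compact_space_geometric_realization_finite:
  assumes "abstract_simplicial_complex K" "finite K"
  shows "compact_space (geometric_realization K)"
proof -
  have "compactin (geometric_realization K) (closed_simplex \<sigma>)" if \<sigma>: "\<sigma> \<in> K" for \<sigma>
    unfolding compactin_def
  proof (intro conjI allI impI)
    show "closed_simplex \<sigma> \<subseteq> topspace (geometric_realization K)"
      using \<sigma> by (auto simp: topspace_geometric_realization)
    fix \<U> assume \<U>: "Ball \<U> (openin (geometric_realization K)) \<and> closed_simplex \<sigma> \<subseteq> \<Union>\<U>"
    then have "\<forall>U\<in>\<U>. \<exists>T. open T \<and> U \<inter> closed_simplex \<sigma> = closed_simplex \<sigma> \<inter> T"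
      by (intro ballI openin_geometric_realization_Int[OF _ \<sigma>]) simp
    \<comment> \<open>\<open>T U\<close> is open in the function space but agrees with
      \<open>U\<close> only on \<open>closed_simplex \<sigma>\<close>. This suffices to turn a
      finite subcover by the \<open>T U\<close> back into one by members of
      \<open>\<U>\<close>.\<close>
    then obtain T where T: "\<And>U. U \<in> \<U> \<Longrightarrow> open (T U)"
      "\<And>U. U \<in> \<U> \<Longrightarrow> U \<inter> closed_simplex \<sigma> = closed_simplex \<sigma> \<inter> T U"
      by metis
    have "finite \<sigma>" using assms(1) \<sigma> by (auto simp: abstract_simplicial_complex_def)
    then have "compact (closed_simplex \<sigma>)" by (rule compact_closed_simplex)
    moreover have "closed_simplex \<sigma> \<subseteq> (\<Union>U\<in>\<U>. T U)" using \<U> T(2) by blast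
    ultimately obtain \<F> where \<F>: "\<F> \<subseteq> \<U>" "finite \<F>" "closed_simplex \<sigma> \<subseteq> (\<Union>U\<in>\<F>. T U)"
      using T(1) by (metis compactE_image)
    have "closed_simplex \<sigma> \<subseteq> \<Union>\<F>"
    proof
      fix x assume x: "x \<in> closed_simplex \<sigma>"
      then obtain U where "U \<in> \<F>" "x \<in> T U" using \<F>(3) by blast
      then show "x \<in> \<Union>\<F>" using T(2)[of U] \<F>(1) x by blast
    qed
    with \<F> show "\<exists>\<F>. finite \<F> \<and> \<F> \<subseteq> \<U> \<and> closed_simplex \<sigma> \<subseteq> \<Union>\<F>" by blast
  qed
  then have "compactin (geometric_realization K) (\<Union>(closed_simplex ` K))"
    using assms(2) by (intro compactin_Union) auto
  then show ?thesis by (simp add: compact_space_def topspace_geometric_realization)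
qed

text \<open>A singleton is a product of closed singletons, hence closed in the product topology over
  any index type.\<close>

lemma finite_closed_fun:
  fixes F :: "('a \<Rightarrow> 'b::t1_space) set"
  assumes "finite F"
  shows "closed F"
proof -
  have "closed {x}" for x :: "'a \<Rightarrow> 'b"
  proof -
    have "closed (PiE UNIV (\<lambda>v. {x v}))"
      unfolding closed_closedin euclidean_product_topology[symmetric] closedin_product_topology
      by (simp flip: closed_closedin)
    then show ?thesis by (simp add: PiE_singleton)
  qed
  then have "closed (\<Union>x\<in>F. {x})" using assms by (intro closed_UN) auto
  then show ?thesis by simp
qed

text \<open>Serves as a marker for its simplex: the support recovers \<open>\<sigma>\<close>, so for
  finite simplices the map is injective, and the point lies in \<open>closed_simplex \<tau>\<close>
  only if \<open>\<sigma> \<subseteq> \<tau>\<close>.\<close>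

definition barycenter :: "'a set \<Rightarrow> 'a \<Rightarrow> real" where
  "barycenter \<sigma> = (\<lambda>v. if v \<in> \<sigma> then 1 / card \<sigma> else 0)"

lemma barycenter_support:
  assumes "finite \<sigma>"
  shows "{v. barycenter \<sigma> v \<noteq> 0} = \<sigma>"
  using assms by (auto simp: barycenter_def)

lemma barycenter_in_closed_simplex:
  assumes "finite \<sigma>" "\<sigma> \<noteq> {}"
  shows "barycenter \<sigma> \<in> closed_simplex \<sigma>"
  using assms by (simp add: closed_simplex_def barycenter_def)

lemma finite_if_compact_geometric_realization:
  assumes "abstract_simplicial_complex K" "compact_space (geometric_realization K)"
  shows "finite K"
proof -
  let ?G = "geometric_realization K" and ?B = "barycenter ` K"
  have K: "finite \<sigma>" "\<sigma> \<noteq> {}" if "\<sigma> \<in> K" for \<sigma>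
    using assms(1) that by (auto simp: abstract_simplicial_complex_def)
  have inj: "inj_on barycenter K"
    by (rule inj_onI) (metis K(1) barycenter_support)
  \<comment> \<open>Deleting every barycentre but one gives an open cover in which each barycentre
    has only its own set, so no finite subfamily covers infinitely many of them.\<close>
  define U where "U \<sigma> = topspace ?G - (?B - {barycenter \<sigma>})" for \<sigma>
  have opn: "openin ?G (U \<sigma>)" for \<sigma>
    unfolding openin_geometric_realization
  proof (intro conjI ballI)
    show "U \<sigma> \<subseteq> (\<Union>\<sigma>\<in>K. closed_simplex \<sigma>)"
      by (auto simp: U_def topspace_geometric_realization)
    fix \<tau> assume \<tau>: "\<tau> \<in> K"
    let ?F = "(?B - {barycenter \<sigma>}) \<inter> closed_simplex \<tau>"
    \<comment> \<open>Only faces of \<open>\<tau>\<close> have their barycentre in this closed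
      simplex. So finitely many points are removed from it, and the trace of
      \<open>U \<sigma>\<close> is relatively open.\<close>
    have "?F \<subseteq> barycenter ` Pow \<tau>"
    proof
      fix x assume x: "x \<in> ?F"
      then obtain \<rho> where \<rho>: "\<rho> \<in> K" "x = barycenter \<rho>" by blast
      with x have "\<rho> \<subseteq> \<tau>"
        using closed_simplex_support_subset[of x \<tau>] barycenter_support[OF K(1)[OF \<rho>(1)]] by auto
      with \<rho> show "x \<in> barycenter ` Pow \<tau>" by blast
    qed
    then have "finite ?F" using K(1)[OF \<tau>] by (meson finite_Pow_iff finite_imageI finite_subset)
    then have "open (- ?F)" by (intro open_Compl finite_closed_fun)
    moreover have "U \<sigma> \<inter> closed_simplex \<tau> = closed_simplex \<tau> \<inter> (- ?F)"
      using \<tau> by (auto simp: U_def topspace_geometric_realization)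
    ultimately show "openin (top_of_set (closed_simplex \<tau>)) (U \<sigma> \<inter> closed_simplex \<tau>)"
      by (metis openin_open_Int)
  qed
  have B: "?B \<subseteq> topspace ?G"
    unfolding topspace_geometric_realization
  proof (intro image_subsetI UN_I)
    fix \<sigma> assume \<sigma>: "\<sigma> \<in> K"
    show "barycenter \<sigma> \<in> closed_simplex \<sigma>"
      using K[OF \<sigma>] by (rule barycenter_in_closed_simplex)
  qed
  have "topspace ?G \<subseteq> (\<Union>\<sigma>\<in>K. U \<sigma>)"
  proof
    fix x assume x: "x \<in> topspace ?G"
    \<comment> \<open>A point that is no barycentre lies in every \<open>U \<sigma>\<close>, but
      some \<open>\<sigma>\<close> must exist for it to be covered.\<close>
    then have "K \<noteq> {}" by (auto simp: topspace_geometric_realization)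
    with x show "x \<in> (\<Union>\<sigma>\<in>K. U \<sigma>)" by (cases "x \<in> ?B") (auto simp: U_def)
  qed
  with opn have "\<exists>\<F>. finite \<F> \<and> \<F> \<subseteq> U ` K \<and> topspace ?G \<subseteq> \<Union>\<F>"
    using assms(2)[unfolded compact_space_alt, rule_format, of "U ` K"] by blast
  then obtain \<F> where \<F>: "finite \<F>" "\<F> \<subseteq> U ` K" "topspace ?G \<subseteq> \<Union>\<F>"
    by (elim exE conjE)
  then obtain L where L: "finite L" "L \<subseteq> K" "\<F> = U ` L"
    by (metis finite_subset_image)
  have "?B \<subseteq> barycenter ` L"
  proof
    fix x assume x: "x \<in> ?B"
    then obtain \<sigma> where "\<sigma> \<in> L" "x \<in> U \<sigma>" using B \<F>(3) L(3) by blast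
    with x show "x \<in> barycenter ` L" by (auto simp: U_def)
  qed
  then have "finite ?B" using L(1) finite_surj by blast
  then show ?thesis using inj by (rule finite_imageD)
qed

section \<open>Isolated vertices\<close>

text \<open>If \<open>v\<close> lies in no edge, then \<open>{v}\<close> is the only simplex
  containing it and its point is clopen. Connectedness makes this point the whole space, while
  \<open>\<sigma>\<close> supplies a second vertex.\<close>

lemma vertex_in_edge_if_connected:
  assumes K: "abstract_simplicial_complex K"
    and conn: "connected_space (geometric_realization K)"
    and \<sigma>: "\<sigma> \<in> K" "card \<sigma> \<ge> 2" and v: "{v} \<in> K"
  shows "\<exists>e\<in>simplices 1 K. v \<in> e"
proof (rule ccontr)
  assume no: "\<not> ?thesis"
  let ?G = "geometric_realization K" and ?p = "vertex_point v"
  have fin: "finite \<tau>" if "\<tau> \<in> K" for \<tau>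
    using K that by (auto simp: abstract_simplicial_complex_def)
  have sing: "\<tau> = {v}" if \<tau>: "\<tau> \<in> K" "v \<in> \<tau>" for \<tau>
  proof (rule ccontr)
    assume "\<tau> \<noteq> {v}"
    then obtain u where u: "u \<in> \<tau>" "u \<noteq> v" using \<tau>(2) by blast
    have "{u, v} \<in> K"
      by (rule face_in_complex[OF K \<tau>(1)]) (use u \<tau>(2) in auto)
    then have "{u, v} \<in> simplices 1 K" using u by (simp add: simplices_def)
    with no show False by blast
  qed
  \<comment> \<open>Hence the traces of \<open>{?p}\<close> and of its complement on any closed
    simplex are empty or the entire simplex, and so relatively open in either case.\<close>
  have cases: "closed_simplex \<tau> = {?p} \<or> ?p \<notin> closed_simplex \<tau>" if "\<tau> \<in> K" for \<tau>
    using sing[OF that] vertex_point_in_closed_simplex_iff[OF fin[OF that]]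
      closed_simplex_singleton by metis
  have p: "?p \<in> topspace ?G"
    using v closed_simplex_singleton[of v] by (auto simp: topspace_geometric_realization)
  have "{?p} \<inter> closed_simplex \<tau> \<in> {{}, closed_simplex \<tau>}"
    "(topspace ?G - {?p}) \<inter> closed_simplex \<tau> \<in> {{}, closed_simplex \<tau>}" if "\<tau> \<in> K" for \<tau>
    using cases[OF that] that by (auto simp: topspace_geometric_realization)
  then have triv: "openin (top_of_set (closed_simplex \<tau>)) ({?p} \<inter> closed_simplex \<tau>)"
    "openin (top_of_set (closed_simplex \<tau>)) ((topspace ?G - {?p}) \<inter> closed_simplex \<tau>)"
    if "\<tau> \<in> K" for \<tau>
    using that by (metis insertE openin_empty openin_subtopology_self singletonD)+
  have "openin ?G {?p}" "openin ?G (topspace ?G - {?p})"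
    using p triv unfolding openin_geometric_realization
    by (auto simp: topspace_geometric_realization)
  then have "topspace ?G = {?p}"
    using conn p unfolding connected_space_clopen_in closedin_def by blast
  moreover obtain u where u: "u \<in> \<sigma>" "u \<noteq> v"
  proof -
    have "\<not> \<sigma> \<subseteq> {v}" using card_mono[of "{v}" \<sigma>] \<sigma>(2) by auto
    then show ?thesis using that by blast
  qed
  moreover have "vertex_point u \<in> topspace ?G"
    using vertex_point_in_closed_simplex_iff[OF fin[OF \<sigma>(1)]] u(1) \<sigma>(1)
    by (auto simp: topspace_geometric_realization)
  ultimately have "vertex_point u v = ?p v" by auto
  with u(2) show False by (simp add: vertex_point_def)
qed

section \<open>Chains of faces\<close>

text \<open>One step of a chain. With it, closure lemmas for relations replace the concatenation and
  reversal of indexed sequences.\<close>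

definition adjacent_rel :: "int \<Rightarrow> 'a set set \<Rightarrow> ('a set \<times> 'a set) set" where
  "adjacent_rel n K = {(\<sigma>, \<sigma>'). \<sigma> \<in> simplices n K \<and> \<sigma>' \<in> simplices n K \<and>
     (\<exists>\<tau>\<in>simplices (n - 1) K. \<tau> \<subseteq> \<sigma> \<and> \<tau> \<subseteq> \<sigma>')}"

text \<open>The reflexive transitive closure relates every set to itself; the intersection restricts
  it to \<open>n\<close>-simplices.\<close>

lemma chain_rel_eq_rtrancl:
  "chain_rel n K = (adjacent_rel n K)\<^sup>* \<inter> simplices n K \<times> simplices n K"
proof (intro equalityI subrelI)
  fix \<sigma> \<sigma>' assume "(\<sigma>, \<sigma>') \<in> chain_rel n K"
  then obtain k :: nat and s where s: "s 0 = \<sigma>" "s k = \<sigma>'" "\<forall>i\<le>k. s i \<in> simplices n K"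
    "\<forall>i<k. \<exists>\<tau>\<in>simplices (n - 1) K. \<tau> \<subseteq> s i \<and> \<tau> \<subseteq> s (Suc i)"
    by (auto simp: chain_rel_def)
  then have "\<forall>i<k. (s i, s (Suc i)) \<in> adjacent_rel n K"
    by (auto simp: adjacent_rel_def)
  then have "(\<sigma>, \<sigma>') \<in> adjacent_rel n K ^^ k"
    using s(1,2) by (auto simp: relpow_fun_conv)
  then have "(\<sigma>, \<sigma>') \<in> (adjacent_rel n K)\<^sup>*" by (rule relpow_imp_rtrancl)
  with s show "(\<sigma>, \<sigma>') \<in> (adjacent_rel n K)\<^sup>* \<inter> simplices n K \<times> simplices n K"
    by auto
next
  fix \<sigma> \<sigma>' assume a: "(\<sigma>, \<sigma>') \<in> (adjacent_rel n K)\<^sup>* \<inter> simplices n K \<times> simplices n K"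
  then obtain k s where s: "s 0 = \<sigma>" "s k = \<sigma>'"
    "\<forall>i<k. (s i, s (Suc i)) \<in> adjacent_rel n K"
    by (auto dest!: rtrancl_imp_relpow simp: relpow_fun_conv)
  \<comment> \<open>For \<open>i < k\<close> the step leaving \<open>s i\<close> gives membership;
    the last index, which for \<open>k = 0\<close> is the only one, relies on the endpoint
    \<open>\<sigma>'\<close> being an \<open>n\<close>-simplex.\<close>
  have "s i \<in> simplices n K" if "i \<le> k" for i
    using that s a by (cases "i = k") (auto simp: adjacent_rel_def)
  with s show "(\<sigma>, \<sigma>') \<in> chain_rel n K"
    by (auto simp: chain_rel_def adjacent_rel_def intro!: exI[of _ k] exI[of _ s])
qed

lemma chain_relI:
  assumes "\<sigma> \<in> simplices n K" "\<sigma>' \<in> simplices n K" "\<tau> \<in> simplices (n - 1) K"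
    "\<tau> \<subseteq> \<sigma>" "\<tau> \<subseteq> \<sigma>'"
  shows "(\<sigma>, \<sigma>') \<in> chain_rel n K"
  using assms by (auto simp: chain_rel_eq_rtrancl adjacent_rel_def)

lemma equiv_chain_rel: "equiv (simplices n K) (chain_rel n K)"
proof (rule equivI)
  show "chain_rel n K \<subseteq> simplices n K \<times> simplices n K"
    by (auto simp: chain_rel_eq_rtrancl)
  show "refl_on (simplices n K) (chain_rel n K)"
    by (auto simp: chain_rel_eq_rtrancl refl_on_def)
  have "sym (adjacent_rel n K)" by (auto simp: sym_def adjacent_rel_def)
  then have "sym ((adjacent_rel n K)\<^sup>*)" by (rule sym_rtrancl)
  then show "sym (chain_rel n K)"
    by (auto simp: chain_rel_eq_rtrancl sym_def)
  show "trans (chain_rel n K)"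
    by (auto simp: chain_rel_eq_rtrancl trans_def)
qed

section \<open>The subcomplex generated by a class\<close>

lemma abstract_simplicial_complex_generated:
  assumes "\<And>\<sigma>. \<sigma> \<in> S \<Longrightarrow> finite \<sigma>"
  shows "abstract_simplicial_complex (generated_subcomplex S)"
  unfolding abstract_simplicial_complex_def
proof (intro ballI conjI allI impI)
  fix \<sigma> \<tau> assume \<sigma>: "\<sigma> \<in> generated_subcomplex S"
  then show "finite \<sigma>" "\<sigma> \<noteq> {}"
    using assms finite_subset by (auto simp: generated_subcomplex_def)
  assume "\<tau> \<subseteq> \<sigma> \<and> \<tau> \<noteq> {}"
  with \<sigma> show "\<tau> \<in> generated_subcomplex S"
    unfolding generated_subcomplex_def by blast
qed

lemma generated_subcomplex_subset:
  assumes "abstract_simplicial_complex K" "S \<subseteq> K"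
  shows "generated_subcomplex S \<subseteq> K"
  using assms by (auto simp: generated_subcomplex_def abstract_simplicial_complex_def)

text \<open>Passing to faces creates no new \<open>n\<close>-simplices: a subset of a finite simplex
  with the same cardinality is that simplex.\<close>

lemma simplices_generated_subcomplex:
  assumes K: "abstract_simplicial_complex K" and S: "S \<subseteq> simplices n K"
  shows "simplices n (generated_subcomplex S) = S"
proof
  have "finite \<sigma>" "\<sigma> \<noteq> {}" "int (card \<sigma>) = n + 1" if "\<sigma> \<in> S" for \<sigma>
    using K S that by (auto simp: simplices_def abstract_simplicial_complex_def)
  note S' = this
  show "S \<subseteq> simplices n (generated_subcomplex S)"
    using S' by (auto simp: simplices_def generated_subcomplex_def)
  show "simplices n (generated_subcomplex S) \<subseteq> S"
  proof
    fix \<tau> assume "\<tau> \<in> simplices n (generated_subcomplex S)"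
    then obtain \<sigma> where "\<sigma> \<in> S" "\<tau> \<subseteq> \<sigma>" "int (card \<tau>) = n + 1"
      by (auto simp: simplices_def generated_subcomplex_def)
    then show "\<tau> \<in> S" using S'(1,3)[of \<sigma>] card_subset_eq[of \<sigma> \<tau>] by auto
  qed
qed

text \<open>A class contains, with one coface of a facet, all its cofaces in \<open>K\<close>.
  Coface counts and chains are therefore the same in the generated subcomplex as in
  \<open>K\<close>, and coherence restricts to it.\<close>

lemma oriented_pseudomanifold_chain_class:
  assumes K: "abstract_simplicial_complex K" and two: "two_cofaces n K"
    and or: "coherently_oriented n K \<omega>" and C: "C \<in> chain_classes n K"
  shows "oriented_pseudomanifold n (generated_subcomplex C) \<omega>"
proof -
  let ?L = "generated_subcomplex C" and ?S = "simplices n K"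
  have CS: "C \<subseteq> ?S" and "C \<noteq> {}"
    using C equiv_chain_rel in_quotient_imp_subset in_quotient_imp_non_empty
    unfolding chain_classes_def by blast+
  have simp: "simplices n ?L = C"
    using K CS by (rule simplices_generated_subcomplex)
  have LK: "?L \<subseteq> K"
    using K CS by (intro generated_subcomplex_subset) (auto simp: simplices_def)
  have SK: "simplices m ?L \<subseteq> simplices m K" for m
    using LK by (auto simp: simplices_def)
  have fin: "finite \<sigma> \<and> \<sigma> \<noteq> {}" if "\<sigma> \<in> C" for \<sigma>
    using CS K that by (auto simp: simplices_def abstract_simplicial_complex_def)
  have closed: "\<sigma>' \<in> C" if "\<sigma> \<in> C" "(\<sigma>, \<sigma>') \<in> chain_rel n K" for \<sigma> \<sigma>'
    using C that equiv_chain_rel in_quotient_imp_closed unfolding chain_classes_def by fastforce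
  have face: "\<tau> \<in> simplices m ?L" if "\<tau> \<in> simplices m K" "\<tau> \<subseteq> \<sigma>" "\<sigma> \<in> C" for \<tau> \<sigma> m
    using that K by (auto simp: simplices_def generated_subcomplex_def
        abstract_simplicial_complex_def)
  have "abstract_simplicial_complex ?L"
    using fin by (intro abstract_simplicial_complex_generated) blast
  moreover have "n_dimensional n ?L"
    unfolding n_dimensional_def simp
  proof (intro conjI ballI)
    fix \<tau> assume "\<tau> \<in> ?L"
    then obtain \<sigma> where \<sigma>: "\<sigma> \<in> C" "\<tau> \<subseteq> \<sigma>" by (auto simp: generated_subcomplex_def)
    then have "card \<tau> \<le> card \<sigma>" using fin by (intro card_mono) auto
    with \<sigma> CS show "int (card \<tau>) \<le> n + 1" by (auto simp: simplices_def)
  \<comment> \<open>The goal left over is that the class is nonempty, which provides an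
    \<open>n\<close>-simplex.\<close>
  qed fact
  moreover have "topspace (geometric_realization ?L) = (\<Union>\<sigma>\<in>simplices n ?L. closed_simplex \<sigma>)"
    unfolding simp using fin by (rule topspace_generated_subcomplex)
  moreover have "two_cofaces n ?L"
    unfolding two_cofaces_def simp
  proof
    fix \<tau> assume \<tau>: "\<tau> \<in> simplices (n - 1) ?L"
    then obtain \<sigma> where \<sigma>: "\<sigma> \<in> C" "\<tau> \<subseteq> \<sigma>"
      by (auto simp: simplices_def generated_subcomplex_def)
    have \<tau>K: "\<tau> \<in> simplices (n - 1) K" using \<tau> SK by blast
    \<comment> \<open>Sharing \<open>\<tau>\<close> with \<open>\<sigma>\<close> is a chain of
      length one, so the second coface cannot lie outside the class.\<close>
    have "\<sigma>' \<in> C" if "\<sigma>' \<in> ?S" "\<tau> \<subseteq> \<sigma>'" for \<sigma>'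
      by (rule closed[OF \<sigma>(1) chain_relI[OF _ that(1) \<tau>K \<sigma>(2) that(2)]]) (use \<sigma>(1) CS in auto)
    then have "{\<sigma> \<in> C. \<tau> \<subseteq> \<sigma>} = {\<sigma> \<in> ?S. \<tau> \<subseteq> \<sigma>}" using CS by blast
    then show "card {\<sigma> \<in> C. \<tau> \<subseteq> \<sigma>} = 2" using two \<tau>K by (simp add: two_cofaces_def)
  qed
  moreover have "(\<sigma>, \<sigma>') \<in> chain_rel n ?L" if \<sigma>: "\<sigma> \<in> C" and \<sigma>': "\<sigma>' \<in> C" for \<sigma> \<sigma>'
  proof -
    have "(\<sigma>, \<sigma>') \<in> chain_rel n K"
      using C \<sigma> \<sigma>' equiv_chain_rel quotient_eq_iff unfolding chain_classes_def by fastforce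
    then have "(\<sigma>, \<sigma>') \<in> (adjacent_rel n K)\<^sup>*" by (simp add: chain_rel_eq_rtrancl)
    \<comment> \<open>Membership in \<open>C\<close> is carried along the induction: a chain that
      starts in the class never leaves it, and so each connecting facet belongs to
      \<open>?L\<close>.\<close>
    then have "(\<sigma>, \<sigma>') \<in> (adjacent_rel n ?L)\<^sup>* \<and> \<sigma>' \<in> C"
    proof induction
      case base
      show ?case using \<sigma> by simp
    next
      case (step \<rho> \<rho>')
      then obtain \<tau> where \<tau>: "\<rho> \<in> ?S" "\<rho>' \<in> ?S" "\<tau> \<in> simplices (n - 1) K" "\<tau> \<subseteq> \<rho>" "\<tau> \<subseteq> \<rho>'"
        by (auto simp: adjacent_rel_def)
      have \<rho>: "\<rho> \<in> C" using step.IH by simp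
      then have \<rho>': "\<rho>' \<in> C" using closed chain_relI[OF \<tau>] by blast
      have "(\<rho>, \<rho>') \<in> adjacent_rel n ?L"
        using \<rho> \<rho>' \<tau> face[OF \<tau>(3,4) \<rho>] by (auto simp: adjacent_rel_def simp)
      with step.IH \<rho>' show ?case by (auto intro: rtrancl_into_rtrancl)
    qed
    with \<sigma> show ?thesis by (simp add: chain_rel_eq_rtrancl simp)
  qed
  ultimately have "pseudomanifold n ?L" by (simp add: pseudomanifold_def simp)
  moreover have "coherently_oriented n ?L \<omega>"
    using or CS SK[of "n - 1"] unfolding coherently_oriented_def simp by (meson subsetD)
  ultimately show ?thesis by (simp add: oriented_pseudomanifold_def)
qed

text \<open>A common facet would make the two simplices adjacent, and then their classes would
  coincide.\<close>

lemma chain_classes_share_no_facet: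
  assumes "C \<in> chain_classes n K" "D \<in> chain_classes n K" "C \<noteq> D"
    and "\<sigma> \<in> C" "\<sigma>' \<in> D" "\<tau> \<in> simplices (n - 1) K"
  shows "\<not> (\<tau> \<subseteq> \<sigma> \<and> \<tau> \<subseteq> \<sigma>')"
proof
  assume "\<tau> \<subseteq> \<sigma> \<and> \<tau> \<subseteq> \<sigma>'"
  moreover have "\<sigma> \<in> simplices n K" "\<sigma>' \<in> simplices n K"
    using assms(1,2,4,5) equiv_chain_rel in_quotient_imp_subset
    unfolding chain_classes_def by blast+
  ultimately have "(\<sigma>, \<sigma>') \<in> chain_rel n K"
    using chain_relI[OF _ _ assms(6)] by blast
  then have "C = D"
    using assms(1,2,4,5) unfolding chain_classes_def by (intro quotient_eqI[OF equiv_chain_rel])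
  with assms(3) show False by contradiction
qed

section \<open>Dimension two: covering by the classes, and their intersections\<close>

theorem proposition2p3:
  fixes X :: "'a set set" and \<omega> :: "'a set \<Rightarrow> 'a list set"
  assumes "abstract_simplicial_complex X"
    and "n_dimensional 2 X"
    and "compact_space (geometric_realization X)"
    and "two_cofaces 2 X"
    and "coherently_oriented 2 X \<omega>"
    and "path_connected_space (geometric_realization X)"
  shows "(\<forall>v. {v} \<in> X \<longrightarrow> (\<exists>e\<in>simplices 1 X. v \<in> e)) \<and>
    equiv (simplices 2 X) (chain_rel 2 X) \<and>
    (\<forall>C\<in>chain_classes 2 X. oriented_pseudomanifold 2 (generated_subcomplex C) \<omega> \<and>
       compact_space (geometric_realization (generated_subcomplex C))) \<and>
    finite (chain_classes 2 X) \<and>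
    topspace (geometric_realization X) = (\<Union>C\<in>chain_classes 2 X. union_of_faces C) \<and>
    (\<forall>C\<in>chain_classes 2 X. \<forall>D\<in>chain_classes 2 X. C \<noteq> D \<longrightarrow>
       finite (union_of_faces C \<inter> union_of_faces D) \<and>
       union_of_faces C \<inter> union_of_faces D \<subseteq> vertex_point ` {v. {v} \<in> X})"
proof -
  note X = assms(1)
  let ?S = "simplices 2 X"
  have finX: "finite X" using assms(1,3) by (rule finite_if_compact_geometric_realization)
  have fin: "finite \<sigma> \<and> \<sigma> \<noteq> {}" if "\<sigma> \<in> X" for \<sigma>
    using X that by (auto simp: abstract_simplicial_complex_def)
  have SX: "?S \<subseteq> X" by (auto simp: simplices_def)
  have CS: "C \<subseteq> ?S" if "C \<in> chain_classes 2 X" for C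
    using that equiv_chain_rel in_quotient_imp_subset unfolding chain_classes_def by blast
  have CX: "C \<subseteq> X" if "C \<in> chain_classes 2 X" for C using CS[OF that] SX by blast
  have union: "union_of_faces C = (\<Union>\<sigma>\<in>C. closed_simplex \<sigma>)" if "C \<in> chain_classes 2 X" for C
    using fin CX[OF that] by (intro topspace_generated_subcomplex) blast

  have vertex: "\<exists>e\<in>simplices 1 X. v \<in> e" if "{v} \<in> X" for v
  proof -
    \<comment> \<open>A 2-face has three vertices, so it is a simplex that excludes a one-point
      space.\<close>
    obtain \<sigma> where "\<sigma> \<in> X" "card \<sigma> = 3"
      using assms(2) by (auto simp: n_dimensional_def simplices_def)
    then show ?thesis
      by (intro vertex_in_edge_if_connected[OF X _ _ _ that, of \<sigma>]
          path_connected_imp_connected_space assms(6)) auto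
  qed

  have edge: "\<exists>\<sigma>\<in>?S. e \<subseteq> \<sigma>" if "e \<in> simplices 1 X" for e
  proof -
    have "card {\<sigma> \<in> ?S. e \<subseteq> \<sigma>} = 2" using assms(4) that by (simp add: two_cofaces_def)
    then have "{\<sigma> \<in> ?S. e \<subseteq> \<sigma>} \<noteq> {}" by (metis card.empty zero_neq_numeral)
    then show ?thesis by blast
  qed
  \<comment> \<open>By dimension: a vertex lies in an edge by connectedness, an edge in a 2-face
    because it has two cofaces, and a 2-face in itself.\<close>
  have face: "\<exists>\<sigma>\<in>?S. \<tau> \<subseteq> \<sigma>" if \<tau>: "\<tau> \<in> X" for \<tau>
  proof -
    have "int (card \<tau>) \<le> 3" using assms(2) \<tau> by (auto simp: n_dimensional_def)
    moreover have "card \<tau> \<noteq> 0" using fin[OF \<tau>] by simp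
    ultimately consider "card \<tau> = 1" | "card \<tau> = 2" | "card \<tau> = 3" by linarith
    then show ?thesis
    proof cases
      case 1
      then obtain v where v: "\<tau> = {v}" by (auto simp: card_1_singleton_iff)
      then show ?thesis using vertex edge \<tau> by blast
    next
      case 2
      then show ?thesis using \<tau> by (intro edge) (simp add: simplices_def)
    next
      case 3
      then show ?thesis using \<tau> by (intro bexI[of _ \<tau>]) (auto simp: simplices_def)
    qed
  qed

  have compact: "compact_space (geometric_realization (generated_subcomplex C))"
    if "C \<in> chain_classes 2 X" for C
  proof (rule compact_space_geometric_realization_finite)
    show "abstract_simplicial_complex (generated_subcomplex C)"
      using fin CX[OF that] by (intro abstract_simplicial_complex_generated) blast
    show "finite (generated_subcomplex C)"
      using generated_subcomplex_subset[OF X CX[OF that]] finX by (rule finite_subset)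
  qed

  have finite: "finite (chain_classes 2 X)"
    unfolding chain_classes_def
  proof (rule finite_quotient)
    show "finite ?S" using finX SX by (rule rev_finite_subset)
    show "chain_rel 2 X \<subseteq> ?S \<times> ?S" by (auto simp: chain_rel_eq_rtrancl)
  qed

  have top: "topspace (geometric_realization X) = (\<Union>C\<in>chain_classes 2 X. union_of_faces C)"
  proof -
    have "topspace (geometric_realization X) = (\<Union>\<sigma>\<in>?S. closed_simplex \<sigma>)"
    proof -
      \<comment> \<open>Since every simplex is a face of a 2-face, the 2-faces generate the complex
        and their union is the whole space.\<close>
      have "generated_subcomplex ?S = X"
        using face fin generated_subcomplex_subset[OF X SX]
        by (auto simp: generated_subcomplex_def)
      then show ?thesis
        using topspace_generated_subcomplex[of ?S] fin SX by (metis subsetD)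
    qed
    also have "?S = \<Union>(chain_classes 2 X)"
      using Union_quotient[OF equiv_chain_rel] unfolding chain_classes_def by blast
    also have "(\<Union>\<sigma>\<in>\<dots>. closed_simplex \<sigma>) = (\<Union>C\<in>chain_classes 2 X. union_of_faces C)"
      using union by simp
    finally show ?thesis .
  qed

  have meet: "union_of_faces C \<inter> union_of_faces D \<subseteq> vertex_point ` {v. {v} \<in> X}"
    if C: "C \<in> chain_classes 2 X" and D: "D \<in> chain_classes 2 X" and "C \<noteq> D" for C D
  proof
    fix x assume "x \<in> union_of_faces C \<inter> union_of_faces D"
    then obtain \<sigma> \<sigma>' where \<sigma>: "\<sigma> \<in> C" "x \<in> closed_simplex \<sigma>"
      and \<sigma>': "\<sigma>' \<in> D" "x \<in> closed_simplex \<sigma>'"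
      using union[OF C] union[OF D] by auto
    note supp = closed_simplex_support_subset[OF \<sigma>(2)] closed_simplex_support_subset[OF \<sigma>'(2)]
    have face: "\<tau> \<in> X" if "\<tau> \<subseteq> \<sigma>" "\<tau> \<noteq> {}" for \<tau>
      by (rule face_in_complex[OF X _ that]) (use CX[OF C] \<sigma>(1) in auto)
    obtain v where v: "x v \<noteq> 0" using closed_simplex_support_nonempty[OF \<sigma>(2)] by blast
    \<comment> \<open>The support of \<open>x\<close> lies in both \<open>\<sigma>\<close> and
      \<open>\<sigma>'\<close>. Two distinct vertices in it would span an edge common to faces of
      different classes.\<close>
    have "u = v" if "x u \<noteq> 0" for u
    proof (rule ccontr)
      assume "u \<noteq> v"
      moreover have "{u, v} \<subseteq> \<sigma>" "{u, v} \<subseteq> \<sigma>'" using supp v that by auto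
      moreover from this have "{u, v} \<in> X" by (intro face) auto
      ultimately show False
        using chain_classes_share_no_facet[OF C D \<open>C \<noteq> D\<close> \<sigma>(1) \<sigma>'(1), of "{u, v}"]
        by (simp add: simplices_def)
    qed
    then have "{u. x u \<noteq> 0} = {v}" using v by blast
    then have "x = vertex_point v"
      using closed_simplex_support_singleton[OF \<sigma>(2)] fin CX[OF C] \<sigma>(1) by blast
    moreover have "{v} \<in> X" using supp(1) v by (intro face) auto
    ultimately show "x \<in> vertex_point ` {v. {v} \<in> X}" by blast
  qed

  \<comment> \<open>The vertices form the preimage of the finite complex under the injection sending
    \<open>v\<close> to \<open>{v}\<close>.\<close>
  have "finite {v. {v} \<in> X}"
    using finite_vimageI[OF finX, of "\<lambda>v. {v}"] by (simp add: vimage_def)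
  then have "finite (union_of_faces C \<inter> union_of_faces D)"
    if "C \<in> chain_classes 2 X" "D \<in> chain_classes 2 X" "C \<noteq> D" for C D
    using finite_subset[OF meet[OF that]] by blast
  then have "\<forall>C\<in>chain_classes 2 X. \<forall>D\<in>chain_classes 2 X. C \<noteq> D \<longrightarrow>
      finite (union_of_faces C \<inter> union_of_faces D) \<and>
      union_of_faces C \<inter> union_of_faces D \<subseteq> vertex_point ` {v. {v} \<in> X}"
    by (intro ballI impI conjI meet)
  moreover have "\<forall>C\<in>chain_classes 2 X.
      oriented_pseudomanifold 2 (generated_subcomplex C) \<omega> \<and>
      compact_space (geometric_realization (generated_subcomplex C))"
    by (intro ballI conjI compact oriented_pseudomanifold_chain_class[OF X assms(4,5)])
  moreover have "\<forall>v. {v} \<in> X \<longrightarrow> (\<exists>e\<in>simplices 1 X. v \<in> e)"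
    by (intro allI impI vertex)
  ultimately show ?thesis
    by (intro conjI equiv_chain_rel finite top)
qed

end
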